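(* Let $\lambda\in[0,1]$, let $y(s)\in\mathbb{R}$ and $\varphi(s)\in\mathbb{R}^p$ for $s\ge 1$, and set $$V(\theta,t)=\sum_{s=1}^{t}\lambda^{t-s}\,\bigl(y(s)-\varphi(s)^T\theta\bigr)^2,\qquad \theta\in\mathbb{R}^p .$$ Let the matrices $R_t$ be given by the updating law $R_t=\lambda R_{t-1}+\varphi(t)\varphi(t)^T$ for $t\ge 1$, with $R_0=0$. Let $t\ge 2$ and let $\hat\theta_{t-1}$ be a minimizer of $V(\cdot,t-1)$ over $\mathbb{R}^p$. Then the problem $$\hat\theta_t=\operatorname*{argmin}_{\theta_t\in\mathbb{R}^p} V(\theta_t,t)$$ is equivalent to the problem $$\hat\theta_t=\operatorname*{argmin}_{\theta_t\in\mathbb{R}^p}\ \bigl(y(t)-\varphi(t)^T\theta_t\bigr)^2+\lambda\,(\theta_t-\hat\theta_{t-1})^T R_{t-1}(\theta_t-\hat\theta_{t-1}),$$ i.e. the two problems have the same minimizers $\theta_t$.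
   Context: The setting is recursive least-squares identification of a SISO ARX model with output $y(t)\in\mathbb{R}$ and input $u(t)\in\mathbb{R}$. Here $p=n+m$ and $\varphi(t)=[\,y(t-1)\ \ldots\ y(t-n)\ \ u(t-1)\ \ldots\ u(t-m)\,]^T\in\mathbb{R}^p$ is the regression vector (any pre-sample values are fixed real numbers). The number $\lambda$ is the forgetting factor; the convention $0^0=1$ is used when $\lambda=0$. *)

theory Defs
  imports "HOL-Analysis.Analysis"
begin

text \<open>Data are sequences indexed by \<open>nat\<close>; only the entries with index at least 1 are used.
  For \<open>lam = 0\<close> the power on natural exponents gives the convention that zero to the zero is one.\<close>

definition rls_cost ::
    "real \<Rightarrow> (nat \<Rightarrow> real) \<Rightarrow> (nat \<Rightarrow> real ^ 'p) \<Rightarrow> real ^ 'p \<Rightarrow> nat \<Rightarrow> real" where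
  "rls_cost lam y \<phi> \<theta> t = (\<Sum>s = 1..t. lam ^ (t - s) * (y s - \<phi> s \<bullet> \<theta>)\<^sup>2)"

definition outer_square :: "real ^ 'p \<Rightarrow> real ^ 'p ^ 'p" where
  "outer_square v = (columnvector v :: real ^ 1 ^ 'p) ** (rowvector v :: real ^ 'p ^ 1)"

abbreviation minimizers :: "('a \<Rightarrow> real) \<Rightarrow> 'a set" where
  "minimizers f \<equiv> {x. is_arg_min f (\<lambda>_. True) x}"

end

theory Submission
  imports Defs
begin

text \<open>The two objective functions differ only by a constant, so they have the same minimizers.
  Splitting off the newest error term gives
  \<open>V(\<theta>, t) = (y t - \<phi> t \<bullet> \<theta>)\<^sup>2 + lam * V(\<theta>, t - 1)\<close> (\<open>rls_cost_Suc\<close>), so it remains to compare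
  the old cost with the quadratic form of \<open>R (t - 1)\<close>.  Unrolling the recursion, \<open>R k\<close> is the
  discounted Gram matrix of the regressors, that is, half the Hessian of the quadratic polynomial
  \<open>V(\<cdot>, k)\<close> (\<open>quadratic_form_eq_rls_cost\<close>).  The exact Taylor expansion of \<open>V(\<cdot>, t - 1)\<close> about the
  minimizer \<open>\<theta>prev\<close> has no linear term (\<open>rls_normal_equations\<close>), so
  \<open>V(\<theta>, t - 1) = V(\<theta>prev, t - 1) + (\<theta> - \<theta>prev) \<bullet> (R (t - 1) *v (\<theta> - \<theta>prev))\<close>, and
  the constant is \<open>lam * V(\<theta>prev, t - 1)\<close>.\<close>

lemma rls_cost_Suc:
  "rls_cost lam y \<phi> \<theta> (Suc k) = (y (Suc k) - \<phi> (Suc k) \<bullet> \<theta>)\<^sup>2 + lam * rls_cost lam y \<phi> \<theta> k"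
proof -
  have "(\<Sum>s = 1..k. lam ^ (Suc k - s) * (y s - \<phi> s \<bullet> \<theta>)\<^sup>2)
      = lam * (\<Sum>s = 1..k. lam ^ (k - s) * (y s - \<phi> s \<bullet> \<theta>)\<^sup>2)"
    unfolding sum_distrib_left
    by (rule sum.cong) (auto simp: Suc_diff_le)
  then show ?thesis
    by (simp add: rls_cost_def)
qed

lemma rls_cost_nonneg:
  "0 \<le> lam \<Longrightarrow> 0 \<le> rls_cost lam y \<phi> \<theta> k"
  by (simp add: rls_cost_def sum_nonneg)

lemma quadratic_form_outer_square:
  "x \<bullet> (outer_square v *v x) = (v \<bullet> x)\<^sup>2"
proof -
  have "outer_square v *v x = (v \<bullet> x) *\<^sub>R v"
    by (simp add: vec_eq_iff outer_square_def matrix_matrix_mult_def matrix_vector_mult_def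
        columnvector_def rowvector_def inner_vec_def sum_distrib_left mult.commute mult.left_commute)
  then show ?thesis
    by (simp add: power2_eq_square inner_commute)
qed

text \<open>The quadratic form of \<open>R k\<close> is the least-squares cost for the zero output signal.  Written
  this way it satisfies the recursion \<open>rls_cost_Suc\<close>, which mirrors the updating law of \<open>R\<close>, and
  it appears directly as the second-order part of the cost in \<open>rls_cost_add\<close>.\<close>

lemma quadratic_form_eq_rls_cost:
  assumes "R 0 = 0"
    and "\<forall>k\<ge>1. R k = lam *\<^sub>R R (k - 1) + outer_square (\<phi> k)"
  shows "x \<bullet> (R k *v x) = rls_cost lam (\<lambda>_. 0) \<phi> x k"
proof (induction k)
  case 0
  show ?case
    by (simp add: assms(1) rls_cost_def)
next
  case (Suc k)
  have "R (Suc k) = lam *\<^sub>R R k + outer_square (\<phi> (Suc k))"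
    using assms(2) by (metis diff_Suc_1 le_add1 plus_1_eq_Suc)
  then have "x \<bullet> (R (Suc k) *v x) = lam * (x \<bullet> (R k *v x)) + (\<phi> (Suc k) \<bullet> x)\<^sup>2"
    by (simp add: matrix_vector_mult_add_rdistrib scaleR_matrix_vector_assoc[symmetric]
        inner_add_right quadratic_form_outer_square)
  then show ?case
    by (simp add: Suc.IH rls_cost_Suc)
qed

lemma rls_cost_add:
  "rls_cost lam y \<phi> (\<theta> + x) k
    = rls_cost lam y \<phi> \<theta> k
      - 2 * (\<Sum>s = 1..k. lam ^ (k - s) * (y s - \<phi> s \<bullet> \<theta>) * (\<phi> s \<bullet> x))
      + rls_cost lam (\<lambda>_. 0) \<phi> x k"
  unfolding rls_cost_def sum_distrib_left sum_subtractf[symmetric] sum.distrib[symmetric]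
  by (rule sum.cong) (simp_all add: inner_add_right power2_eq_square algebra_simps)

lemma rls_cost_zero_scaleR:
  "rls_cost lam (\<lambda>_. 0) \<phi> (c *\<^sub>R x) k = c\<^sup>2 * rls_cost lam (\<lambda>_. 0) \<phi> x k"
  by (simp add: rls_cost_def sum_distrib_left power_mult_distrib algebra_simps)

text \<open>First-order optimality, tested along the line \<open>\<theta> + c *\<^sub>R x\<close>: there the cost exceeds its minimum
  by \<open>c\<^sup>2 * Q - 2 * c * G\<close> with \<open>Q \<ge> 0\<close>, which takes negative values near \<open>c = 0\<close> unless \<open>G = 0\<close>.\<close>

lemma rls_normal_equations:
  assumes "0 \<le> lam"
    and min: "\<And>\<theta>'. rls_cost lam y \<phi> \<theta> k \<le> rls_cost lam y \<phi> \<theta>' k"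
  shows "(\<Sum>s = 1..k. lam ^ (k - s) * (y s - \<phi> s \<bullet> \<theta>) * (\<phi> s \<bullet> x)) = 0"
proof -
  define G where "G = (\<Sum>s = 1..k. lam ^ (k - s) * (y s - \<phi> s \<bullet> \<theta>) * (\<phi> s \<bullet> x))"
  define Q where "Q = rls_cost lam (\<lambda>_. 0) \<phi> x k"
  have "Q \<ge> 0"
    unfolding Q_def using assms(1) by (rule rls_cost_nonneg)
  have linear: "(\<Sum>s = 1..k. lam ^ (k - s) * (y s - \<phi> s \<bullet> \<theta>) * (\<phi> s \<bullet> (c *\<^sub>R x))) = c * G" for c
    unfolding G_def sum_distrib_left by (rule sum.cong) simp_all
  have increment: "2 * (c * G) \<le> c\<^sup>2 * Q" for c
    using min[of "\<theta> + c *\<^sub>R x"]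
    by (simp only: rls_cost_add linear rls_cost_zero_scaleR Q_def[symmetric])
  \<comment> \<open>The minimizing step would be \<open>G / Q\<close>; adding 1 keeps the denominator positive when \<open>Q = 0\<close>.\<close>
  define c where "c = G / (Q + 1)"
  have "G = c * (Q + 1)"
    using \<open>Q \<ge> 0\<close> by (simp add: c_def)
  then have "c\<^sup>2 * (Q + 2) \<le> 0"
    using increment[of c] by (simp add: power2_eq_square algebra_simps)
  then have "c = 0"
    using \<open>Q \<ge> 0\<close> by (simp add: mult_le_0_iff)
  then show ?thesis
    using \<open>G = c * (Q + 1)\<close> by (simp add: G_def)
qed

theorem mainTheorem1:
  fixes lam :: real
    and y :: "nat \<Rightarrow> real"
    and \<phi> :: "nat \<Rightarrow> real ^ 'p"
    and R :: "nat \<Rightarrow> real ^ 'p ^ 'p"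
    and t :: nat
    and \<theta>prev :: "real ^ 'p"
  assumes "0 \<le> lam" and "lam \<le> 1"
    and "R 0 = 0"
    and "\<forall>k\<ge>1. R k = lam *\<^sub>R R (k - 1) + outer_square (\<phi> k)"
    and "t \<ge> 2"
    and "\<theta>prev \<in> minimizers (\<lambda>\<theta>. rls_cost lam y \<phi> \<theta> (t - 1))"
  shows "minimizers (\<lambda>\<theta>. rls_cost lam y \<phi> \<theta> t) =
         minimizers (\<lambda>\<theta>. (y t - \<phi> t \<bullet> \<theta>)\<^sup>2
                        + lam * ((\<theta> - \<theta>prev) \<bullet> (R (t - 1) *v (\<theta> - \<theta>prev))))"
proof -
  obtain k where t: "t = Suc k"
    using assms(5) by (cases t) auto
  have min: "rls_cost lam y \<phi> \<theta>prev k \<le> rls_cost lam y \<phi> \<theta> k" for \<theta>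
    using assms(6) by (simp add: t is_arg_min_linorder)
  have old_cost: "rls_cost lam y \<phi> \<theta> k
      = rls_cost lam y \<phi> \<theta>prev k + (\<theta> - \<theta>prev) \<bullet> (R k *v (\<theta> - \<theta>prev))" for \<theta>
    using rls_cost_add[of lam y \<phi> \<theta>prev "\<theta> - \<theta>prev" k]
      rls_normal_equations[OF assms(1) min, of "\<theta> - \<theta>prev"]
      quadratic_form_eq_rls_cost[OF assms(3,4), of "\<theta> - \<theta>prev" k]
    by simp
  have "rls_cost lam y \<phi> \<theta> t
      = ((y t - \<phi> t \<bullet> \<theta>)\<^sup>2 + lam * ((\<theta> - \<theta>prev) \<bullet> (R (t - 1) *v (\<theta> - \<theta>prev))))
        + lam * rls_cost lam y \<phi> \<theta>prev k" for \<theta>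
    by (simp add: t rls_cost_Suc old_cost[of \<theta>] distrib_left)
  then show ?thesis
    by (simp add: is_arg_min_linorder)
qed

end
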